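(* Let $(X,\tau,\mathcal{I})$ be an ideal topological space and let $A,B\subseteq X$. Then the following statements hold: (a) $A\subseteq B\Rightarrow A^\sharp\subseteq B^\sharp$; (b) $A^\sharp=cl(A^\sharp)\subseteq cl(A)$; (c) $(A\cap B)^\sharp\subseteq A^\sharp\cap B^\sharp$; (d) $(A\cup B)^\sharp=A^\sharp\cup B^\sharp$; (e) $A^\sharp\setminus B^\sharp\subseteq(A\setminus B)^\sharp$; (f) $A\in Ann(\mathcal{I})\Rightarrow A^\sharp=\emptyset$; (g) $A\in Ann(\mathcal{I})\Rightarrow (A\cup B)^\sharp=B^\sharp=(A\setminus B)^\sharp$ is to be read with the set difference in the form $(A\cup B)^\sharp=B^\sharp=(B\setminus A)^\sharp$; (h) if $\mathcal{I}$ is faithful, then $A^\sharp=cl(A)$.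
   Context: An ideal on a set $X$ is a non-empty family $\mathcal{I}\subseteq 2^X$ ($2^X$ is the power set of $X$) closed under taking subsets and finite unions. An ideal topological space $(X,\tau,\mathcal{I})$ is a topological space $(X,\tau)$ together with an ideal $\mathcal{I}$ on $X$. $\tau(x)$ denotes the collection of all open sets containing $x$, $cl$ is the closure in $(X,\tau)$, and $S^c=X\setminus S$. For $A\subseteq X$, the sharp function is $A^\sharp=A^\sharp(\mathcal{I},\tau)=\{x\in X\mid(\forall U\in\tau(x))(\exists I\in\mathcal{I}\setminus\{\emptyset\})(I\cap(U\cap A)^c=\emptyset)\}$. The annihilator of $\mathcal{I}$ is $Ann(\mathcal{I})=\{A\subseteq X\mid(\forall I\in\mathcal{I})(A\cap I=\emptyset)\}$, and $\mathcal{I}$ is faithful if $Ann(\mathcal{I})=\{\emptyset\}$. *)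

theory Defs
  imports "HOL-Analysis.Analysis"
begin

definition set_ideal :: "'a set \<Rightarrow> 'a set set \<Rightarrow> bool" where
  "set_ideal X I \<longleftrightarrow>
     I \<subseteq> Pow X \<and> I \<noteq> {} \<and>
     (\<forall>A\<in>I. \<forall>B. B \<subseteq> A \<longrightarrow> B \<in> I) \<and>
     (\<forall>A\<in>I. \<forall>B\<in>I. A \<union> B \<in> I)"

text \<open>
  The whole space is the carrier of the topology, so complements are relative to it.
\<close>

definition ideal_topological_space :: "'a topology \<Rightarrow> 'a set set \<Rightarrow> bool" where
  "ideal_topological_space T I \<longleftrightarrow> set_ideal (topspace T) I"

definition sharp :: "'a set set \<Rightarrow> 'a topology \<Rightarrow> 'a set \<Rightarrow> 'a set" where
  "sharp I T A =
     {x \<in> topspace T. \<forall>U. openin T U \<and> x \<in> U \<longrightarrow>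
        (\<exists>J \<in> I - {{}}. J \<inter> (topspace T - (U \<inter> A)) = {})}"

definition annihilator :: "'a set \<Rightarrow> 'a set set \<Rightarrow> 'a set set" where
  "annihilator X I = {A. A \<subseteq> X \<and> (\<forall>J\<in>I. A \<inter> J = {})}"

definition faithful_ideal :: "'a set \<Rightarrow> 'a set set \<Rightarrow> bool" where
  "faithful_ideal X I \<longleftrightarrow> annihilator X I = {{}}"

end

theory Submission
  imports Defs
begin

text \<open>
  A point \<open>y\<close> lies in some member of an ideal exactly when the singleton \<open>{y}\<close> is itself a member.
  Hence a set contains a non-empty member of the ideal if and only if it meets the union of the
  ideal, and the sharp function turns out to be a closure in disguise: the sharp of \<open>A\<close> is the
  closure of \<open>A \<inter> \<Union>I\<close> (lemma \<open>sharp_eq_closure_of\<close>).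

  All the claims then follow from the fact that closure is a monotone, idempotent operator
  preserving finite unions, applied to the sets \<open>A \<inter> \<Union>I\<close>. The annihilator consists of the subsets
  of the space disjoint from \<open>\<Union>I\<close>, so its members contribute nothing to these traces; and
  faithfulness says that \<open>\<Union>I\<close> is the whole space, so that the trace of \<open>A\<close> is \<open>A\<close> itself.
\<close>

lemma ideal_nonempty_member_subset_iff:
  assumes "set_ideal X I"
  shows "(\<exists>J \<in> I - {{}}. J \<subseteq> W) \<longleftrightarrow> W \<inter> \<Union>I \<noteq> {}"
proof
  assume "W \<inter> \<Union>I \<noteq> {}"
  then obtain y J where y: "y \<in> W" "y \<in> J" "J \<in> I"
    by blast
  then have "{y} \<in> I"
    using assms unfolding set_ideal_def by blast
  then show "\<exists>J \<in> I - {{}}. J \<subseteq> W"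
    using y(1) by blast
qed blast

lemma sharp_eq_closure_of:
  assumes "ideal_topological_space T I"
  shows "sharp I T A = T closure_of (A \<inter> \<Union>I)"
proof -
  have ideal: "set_ideal (topspace T) I"
    using assms unfolding ideal_topological_space_def .
  then have sub: "J \<subseteq> topspace T" if "J \<in> I" for J
    using that unfolding set_ideal_def by (meson PowD subsetD)
  have "(\<exists>J \<in> I - {{}}. J \<inter> (topspace T - (U \<inter> A)) = {})
      \<longleftrightarrow> (\<exists>y \<in> A \<inter> \<Union>I. y \<in> U)" for U
  proof -
    have "(\<exists>J \<in> I - {{}}. J \<inter> (topspace T - (U \<inter> A)) = {}) \<longleftrightarrow> (\<exists>J \<in> I - {{}}. J \<subseteq> U \<inter> A)"
      using sub by blast
    then show ?thesis
      using ideal_nonempty_member_subset_iff[OF ideal, of "U \<inter> A"] by blast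
  qed
  then show ?thesis
    unfolding sharp_def closure_of_def by (simp only: conj_commute)
qed

lemma annihilator_iff_disjoint_Union:
  "A \<in> annihilator X I \<longleftrightarrow> A \<subseteq> X \<and> A \<inter> \<Union>I = {}"
  unfolding annihilator_def by blast

text \<open>
  A point outside \<open>\<Union>I\<close> would give a singleton in the annihilator.
\<close>

lemma faithful_ideal_Union_eq:
  assumes "set_ideal X I" and "faithful_ideal X I"
  shows "\<Union>I = X"
proof
  show "\<Union>I \<subseteq> X"
    using assms(1) unfolding set_ideal_def by (meson Sup_least PowD subsetD)
  show "X \<subseteq> \<Union>I"
  proof
    fix x assume "x \<in> X"
    moreover have "{x} \<notin> annihilator X I"
      using assms(2) unfolding faithful_ideal_def by blast
    ultimately show "x \<in> \<Union>I"
      unfolding annihilator_iff_disjoint_Union by blast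
  qed
qed

theorem theorem6p3:
  fixes T :: "'a topology" and I :: "'a set set" and A B :: "'a set"
  assumes "ideal_topological_space T I"
    and "A \<subseteq> topspace T" and "B \<subseteq> topspace T"
  shows "(A \<subseteq> B \<longrightarrow> sharp I T A \<subseteq> sharp I T B) \<and>
    (sharp I T A = T closure_of (sharp I T A) \<and>
      T closure_of (sharp I T A) \<subseteq> T closure_of A) \<and>
    (sharp I T (A \<inter> B) \<subseteq> sharp I T A \<inter> sharp I T B) \<and>
    (sharp I T (A \<union> B) = sharp I T A \<union> sharp I T B) \<and>
    (sharp I T A - sharp I T B \<subseteq> sharp I T (A - B)) \<and>
    (A \<in> annihilator (topspace T) I \<longrightarrow> sharp I T A = {}) \<and>
    (A \<in> annihilator (topspace T) I \<longrightarrow>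
      sharp I T (A \<union> B) = sharp I T B \<and> sharp I T B = sharp I T (B - A)) \<and>
    (faithful_ideal (topspace T) I \<longrightarrow> sharp I T A = T closure_of A)"
proof -
  let ?S = "\<Union>I"
  note sharp_eq = sharp_eq_closure_of[OF assms(1)]
  have mono: "sharp I T C \<subseteq> sharp I T D" if "C \<subseteq> D" for C D
    unfolding sharp_eq using that by (intro closure_of_mono) blast
  have closed: "sharp I T A = T closure_of (sharp I T A)"
    unfolding sharp_eq by simp
  have le_closure: "sharp I T A \<subseteq> T closure_of A"
    unfolding sharp_eq by (intro closure_of_mono) blast
  have union: "sharp I T (C \<union> D) = sharp I T C \<union> sharp I T D" for C D
    unfolding sharp_eq by (simp add: Int_Un_distrib2)
  have diff: "sharp I T A - sharp I T B \<subseteq> sharp I T (A - B)"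
    using union[of "A - B" B] mono[of A "A - B \<union> B"] by blast
  have ann_empty: "sharp I T A = {}" if "A \<in> annihilator (topspace T) I"
    using that unfolding sharp_eq annihilator_iff_disjoint_Union by simp
  have ann_diff: "sharp I T B = sharp I T (B - A)" if "A \<in> annihilator (topspace T) I"
  proof -
    have "B \<inter> ?S = (B - A) \<inter> ?S"
      using that unfolding annihilator_iff_disjoint_Union by blast
    then show ?thesis
      unfolding sharp_eq by simp
  qed
  have faithful: "sharp I T A = T closure_of A" if "faithful_ideal (topspace T) I"
  proof -
    have "?S = topspace T"
      using faithful_ideal_Union_eq that assms(1) unfolding ideal_topological_space_def by blast
    then show ?thesis
      unfolding sharp_eq using assms(2) by (simp add: Int_absorb2)
  qed
  show ?thesis
  proof (intro conjI impI)
    show "T closure_of (sharp I T A) \<subseteq> T closure_of A"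
      using closed le_closure by simp
    show "sharp I T (A \<union> B) = sharp I T B" if "A \<in> annihilator (topspace T) I"
      using union ann_empty[OF that] by simp
  qed (assumption | rule mono closed union diff ann_empty ann_diff faithful
      Int_greatest Int_lower1 Int_lower2)+
qed

end
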